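(* Let $V$ and $E$ be real reflexive Banach spaces, let $X$ be a real Banach space, let $f\in V^*$, and let $K\subset V$ and $Y\subset E$ be nonempty, closed and convex. Let $A\colon V\to V^*$, $J\colon X\to\mathbb{R}$, $h\colon V\to\mathbb{R}$, $\gamma\colon V\to X$ and $b\colon V\times E\to\mathbb{R}$ satisfy: (1) for all $w,v\in V$, $\limsup_{t\to0^+}\langle A(tw+(1-t)v),w-v\rangle\le\langle A(v),w-v\rangle$; (2) $\langle A(u)+\gamma^*\xi_u-A(v)-\gamma^*\xi_v,u-v\rangle\ge h(u-v)$ for all $u,v\in V$, $\xi_u\in\partial J(\gamma u)$, $\xi_v\in\partial J(\gamma v)$; (3) $J$ is locally Lipschitz continuous; (4) $h(0_V)=0$ and $\limsup_{t\to0^+}\frac{h(tv)}{t}\ge0$ for all $v\in V$; (5) $\gamma$ is linear and continuous; (6) $b$ is bilinear and bounded. Then, for $(u,\lambda)\in K\times Y$, the following four statements are equivalent. (0) $\langle A(u),v-u\rangle+b(v-u,\lambda)+J^0(\gamma u;\gamma v-\gamma u)\ge\langle f,v-u\rangle$ for all $v\in K$, and $b(u,\rho-\lambda)\le0$ for all $\rho\in Y$. (i) $\langle A(v),v-u\rangle+b(v-u,\lambda)+J^0(\gamma v;\gamma v-\gamma u)\ge\langle f,v-u\rangle+h(v-u)$ for all $v\in K$, and $b(u,\rho-\lambda)\le0$ for all $\rho\in Y$. (ii) $\langle A(u),v-u\rangle+b(v,\lambda)-b(u,\rho)+J^0(\gamma u;\gamma v-\gamma u)\ge\langle f,v-u\rangle$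 for all $v\in K$ and all $\rho\in Y$. (iii) $\langle A(v),v-u\rangle+b(v,\lambda)-b(u,\rho)+J^0(\gamma v;\gamma v-\gamma u)\ge\langle f,v-u\rangle+h(v-u)$ for all $v\in K$ and all $\rho\in Y$.
   Context: $\langle\cdot,\cdot\rangle$ is the duality pairing between $V^*$ and $V$, and $\gamma^*\colon X^*\to V^*$ is the adjoint of $\gamma$. For a locally Lipschitz function $J\colon X\to\mathbb{R}$, the generalized (Clarke) directional derivative at $x\in X$ in the direction $z\in X$ is $J^0(x;z)=\limsup_{t\to0^+,\,y\to x}\frac{J(y+tz)-J(y)}{t}$, and the generalized gradient is $\partial J(x)=\{\xi\in X^*\mid J^0(x;z)\ge\langle\xi,z\rangle_{X^*\times X}\text{ for all }z\in X\}$. A bilinear $b$ is bounded if $|b(v,\rho)|\le M\|v\|_V\|\rho\|_E$ for some $M\geq 0$ and all $v\in V$, $\rho\in E$. *)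

theory Defs
  imports "HOL-Analysis.Analysis"
begin

text \<open>The topological dual of a real normed space \<open>'a\<close> is the type \<open>'a \<Rightarrow>\<^sub>L real\<close>, and the
  duality pairing of \<open>\<phi>\<close> with \<open>x\<close> is the application \<open>\<phi> x\<close>.\<close>

definition bidual_embedding ::
    "'a::real_normed_vector \<Rightarrow> (('a \<Rightarrow>\<^sub>L real) \<Rightarrow>\<^sub>L real)" where
  "bidual_embedding x = Blinfun (\<lambda>\<phi>. blinfun_apply \<phi> x)"

lemma bidual_embedding_apply [simp]:
  "blinfun_apply (bidual_embedding x) \<phi> = blinfun_apply \<phi> x"
  unfolding bidual_embedding_def
  by (simp add: bounded_linear_Blinfun_apply blinfun.bounded_linear_left)

definition reflexive_space :: "'a::real_normed_vector itself \<Rightarrow> bool" where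
  "reflexive_space (_ :: 'a itself) \<longleftrightarrow>
     surj (bidual_embedding :: 'a \<Rightarrow> (('a \<Rightarrow>\<^sub>L real) \<Rightarrow>\<^sub>L real))"

definition dual_adjoint ::
    "('a::real_normed_vector \<Rightarrow>\<^sub>L 'b::real_normed_vector) \<Rightarrow> ('b \<Rightarrow>\<^sub>L real) \<Rightarrow> ('a \<Rightarrow>\<^sub>L real)" where
  "dual_adjoint \<gamma> \<xi> = \<xi> o\<^sub>L \<gamma>"

definition locally_lipschitz :: "('a::metric_space \<Rightarrow> 'b::metric_space) \<Rightarrow> bool" where
  "locally_lipschitz J \<longleftrightarrow> (\<forall>x. \<exists>r>0. \<exists>L. L-lipschitz_on (ball x r) J)"

text \<open>The upper limit is taken jointly in \<open>y\<close> and \<open>t\<close>, with \<open>y = x\<close> allowed. It is an extended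
  real, so that it is meaningful for every \<open>J\<close>; it is finite if \<open>J\<close> is locally Lipschitz.\<close>

definition clarke_derivative :: "('a::real_normed_vector \<Rightarrow> real) \<Rightarrow> 'a \<Rightarrow> 'a \<Rightarrow> ereal" where
  "clarke_derivative J x z =
     Limsup (nhds x \<times>\<^sub>F at_right 0) (\<lambda>(y, t). ereal ((J (y + t *\<^sub>R z) - J y) / t))"

definition clarke_gradient :: "('a::real_normed_vector \<Rightarrow> real) \<Rightarrow> 'a \<Rightarrow> ('a \<Rightarrow>\<^sub>L real) set" where
  "clarke_gradient J x = {\<xi>. \<forall>z. clarke_derivative J x z \<ge> ereal (blinfun_apply \<xi> z)}"

end

theory Submission
  imports Defs
begin

text \<open>Statements (0) and (ii), and likewise (i) and (iii), differ only by the choices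
  \<open>\<rho> = \<lambda>\<close> and \<open>v = u\<close>. For (0) \<open>\<Longrightarrow>\<close> (i), Hahn--Banach gives a
  \<open>\<xi>\<^sub>u \<in> \<partial>J(\<gamma>u)\<close> that attains \<open>J\<^sup>0(\<gamma>u; \<gamma>v - \<gamma>u)\<close>, and monotonicity with any
  \<open>\<xi>\<^sub>v \<in> \<partial>J(\<gamma>v)\<close> yields the claim. For (i) \<open>\<Longrightarrow>\<close> (0), apply (i) at \<open>u + t(v - u)\<close>, divide by \<open>t\<close>
  and let \<open>t \<rightarrow> 0\<close>, using that \<open>J\<^sup>0\<close> is upper semicontinuous in its first argument (Minty's trick).\<close>

section \<open>Sublinear functionals\<close>

text \<open>Homogeneity is asked only as an inequality for \<open>c > 0\<close>, the form that an
  estimate of upper limits delivers; equality follows by scaling back with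
  \<open>inverse c\<close>.\<close>

definition sublinear :: "('a::real_vector \<Rightarrow> real) \<Rightarrow> bool" where
  "sublinear q \<longleftrightarrow> (\<forall>x y. q (x + y) \<le> q x + q y) \<and> (\<forall>c>0. \<forall>x. q (c *\<^sub>R x) \<le> c * q x)"

lemma sublinear_add: "sublinear q \<Longrightarrow> q (x + y) \<le> q x + q y"
  by (simp add: sublinear_def)

lemma sublinear_scaleR:
  assumes q: "sublinear q" and c: "c > 0"
  shows "q (c *\<^sub>R x) = c * q x"
proof (rule antisym)
  show "q (c *\<^sub>R x) \<le> c * q x"
    using assms by (simp add: sublinear_def)
  have "q (inverse c *\<^sub>R c *\<^sub>R x) \<le> inverse c * q (c *\<^sub>R x)"
    using assms positive_imp_inverse_positive[OF c] unfolding sublinear_def by blast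
  then show "c * q x \<le> q (c *\<^sub>R x)"
    using c by (simp add: field_simps)
qed

lemma sublinear_zero: "sublinear q \<Longrightarrow> q 0 = 0"
  using sublinear_scaleR[of q 2 0] by simp

lemma sublinear_lower: "sublinear q \<Longrightarrow> - q (- x) \<le> q x"
  using sublinear_add[of q x "- x"] sublinear_zero[of q] by simp

text \<open>The witness is the infimum of \<open>q (x + t *\<^sub>R a) - t * q a\<close> over
  \<open>t \<ge> 0\<close>; the two bounds are the cases \<open>t = 0\<close> and
  \<open>t = 1\<close>. The second bound forces additivity of a minimal \<open>q\<close>, and later
  makes a linear functional below \<open>r\<close> touch \<open>q\<close> at
  \<open>a\<close>.\<close>

lemma sublinear_sharpen:
  assumes q: "sublinear q"
  obtains r where "sublinear r" "\<And>x. r x \<le> q x" "\<And>x. r x \<le> q (x + a) - q a"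
proof -
  define g where "g x t = q (x + t *\<^sub>R a) - t * q a" for x t
  define r where "r x = (INF t\<in>{0..}. g x t)" for x
  \<comment> \<open>A lower bound independent of \<open>t\<close>, so that the infimum is a genuine
    one.\<close>
  have lb: "- q (- x) \<le> g x t" if "t \<ge> 0" for x t
  proof -
    have "q (t *\<^sub>R a) = t * q a"
      using that sublinear_scaleR[OF q, of t a] sublinear_zero[OF q] by (cases "t = 0") auto
    moreover have "q (t *\<^sub>R a) \<le> q (x + t *\<^sub>R a) + q (- x)"
      using sublinear_add[OF q, of "x + t *\<^sub>R a" "- x"] by simp
    ultimately show ?thesis by (simp add: g_def)
  qed
  have r_le: "r x \<le> g x t" if "t \<ge> 0" for x t
    unfolding r_def using that lb by (intro cINF_lower bdd_belowI2[where m = "- q (- x)"]) auto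
  have r_ge: "c \<le> r x" if "\<And>t. t \<ge> 0 \<Longrightarrow> c \<le> g x t" for c x
    unfolding r_def using that by (intro cINF_greatest) auto
  have "r (x + y) \<le> r x + r y" for x y
  proof -
    \<comment> \<open>The parameters \<open>s\<close> and \<open>t\<close> are independent and add
      up on the left. The infimum on the right can then be taken in one variable at a time.\<close>
    have *: "r (x + y) \<le> g x s + g y t" if "s \<ge> 0" "t \<ge> 0" for s t
    proof -
      have "r (x + y) \<le> g (x + y) (s + t)" using that r_le by simp
      also have "\<dots> \<le> g x s + g y t"
        using sublinear_add[OF q, of "x + s *\<^sub>R a" "y + t *\<^sub>R a"]
        by (simp add: g_def algebra_simps)
      finally show ?thesis .
    qed
    have "r (x + y) - g y t \<le> r x" if "t \<ge> 0" for t
      using *[OF _ that] by (intro r_ge) (simp add: algebra_simps)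
    then have "r (x + y) - r x \<le> r y"
      by (intro r_ge) (simp add: algebra_simps)
    then show ?thesis by simp
  qed
  moreover have "r (c *\<^sub>R x) \<le> c * r x" if c: "c > 0" for c x
  proof -
    have "r (c *\<^sub>R x) / c \<le> g x t" if "t \<ge> 0" for t
    proof -
      have "r (c *\<^sub>R x) \<le> g (c *\<^sub>R x) (c * t)" using that c r_le by simp
      also have "\<dots> = c * g x t"
        using sublinear_scaleR[OF q c, of "x + t *\<^sub>R a"] by (simp add: g_def algebra_simps)
      finally show ?thesis using c by (simp add: field_simps)
    qed
    then have "r (c *\<^sub>R x) / c \<le> r x" by (rule r_ge)
    then show ?thesis using c by (simp add: field_simps)
  qed
  ultimately have "sublinear r" by (simp add: sublinear_def)
  moreover have "r x \<le> q x" "r x \<le> q (x + a) - q a" for x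
    using r_le[of 0 x] r_le[of 1 x] by (simp_all add: g_def)
  ultimately show ?thesis using that by blast
qed

text \<open>An infimum of sublinear functionals is in general not subadditive. In a chain, however,
  any \<open>r\<close> and \<open>s\<close> have a smaller one \<open>m\<close> among them, and
  \<open>m (x + y) \<le> m x + m y \<le> r x + s y\<close>. The common majorant \<open>p\<close>
  bounds the values at \<open>x\<close> below by \<open>- p (- x)\<close>.\<close>

lemma sublinear_INF_chain:
  assumes "C \<noteq> {}" and C: "\<And>r. r \<in> C \<Longrightarrow> sublinear r \<and> r \<le> p"
    and chain: "\<And>r s. r \<in> C \<Longrightarrow> s \<in> C \<Longrightarrow> r \<le> s \<or> s \<le> r"
  defines "q \<equiv> \<lambda>x. INF r\<in>C. r x"
  shows "sublinear q" and "\<And>r. r \<in> C \<Longrightarrow> q \<le> r"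
proof -
  have lb: "- p (- x) \<le> r x" if "r \<in> C" for r x
    using C[OF that] sublinear_lower[of r x] le_funD[of r p "- x"] by linarith
  have q_le: "q x \<le> r x" if "r \<in> C" for r x
    unfolding q_def using that lb by (intro cINF_lower bdd_belowI2[where m = "- p (- x)"]) auto
  have q_ge: "c \<le> q x" if "\<And>r. r \<in> C \<Longrightarrow> c \<le> r x" for c x
    unfolding q_def using that \<open>C \<noteq> {}\<close> by (intro cINF_greatest) auto
  show "q \<le> r" if "r \<in> C" for r
    using q_le[OF that] by (simp add: le_fun_def)
  have "q (x + y) \<le> q x + q y" for x y
  proof -
    have *: "q (x + y) \<le> r x + s y" if rs: "r \<in> C" "s \<in> C" for r s
    proof -
      have "\<exists>m\<in>C. m \<le> r \<and> m \<le> s" using chain[OF rs] rs by auto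
      then obtain m where m: "m \<in> C" "m \<le> r" "m \<le> s" by blast
      have "q (x + y) \<le> m (x + y)" by (rule q_le[OF m(1)])
      also have "\<dots> \<le> m x + m y" using C[OF m(1)] sublinear_add by blast
      also have "\<dots> \<le> r x + s y" using m(2,3) by (simp add: add_mono le_funD)
      finally show ?thesis .
    qed
    have "q (x + y) - s y \<le> q x" if "s \<in> C" for s
      using *[OF _ that] by (intro q_ge) (simp add: algebra_simps)
    then have "q (x + y) - q x \<le> q y"
      by (intro q_ge) (simp add: algebra_simps)
    then show ?thesis by simp
  qed
  moreover have "q (c *\<^sub>R x) \<le> c * q x" if c: "c > 0" for c x
  proof -
    have "q (c *\<^sub>R x) / c \<le> r x" if "r \<in> C" for r
    proof -
      have "q (c *\<^sub>R x) \<le> r (c *\<^sub>R x)" by (rule q_le[OF that])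
      also have "\<dots> = c * r x" using C[OF that] c sublinear_scaleR by blast
      finally show ?thesis using c by (simp add: field_simps)
    qed
    then have "q (c *\<^sub>R x) / c \<le> q x" by (rule q_ge)
    then show ?thesis using c by (simp add: field_simps)
  qed
  ultimately show "sublinear q" by (simp add: sublinear_def)
qed

text \<open>Sharpening \<open>q\<close> in any direction \<open>a\<close> must return
  \<open>q\<close> itself, so the second bound of the sharpening becomes superadditivity.\<close>

lemma linear_if_minimal_sublinear:
  assumes q: "sublinear q" and min: "\<And>r. sublinear r \<Longrightarrow> r \<le> q \<Longrightarrow> r = q"
  shows "linear q"
proof -
  have super: "q x + q a \<le> q (x + a)" for x a
  proof -
    obtain r where "sublinear r" "\<And>x. r x \<le> q x" and r: "\<And>x. r x \<le> q (x + a) - q a"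
      using sublinear_sharpen[OF q] by blast
    then have "r = q" using min by (simp add: le_fun_def)
    then show ?thesis using r[of x] by simp
  qed
  have add: "q (x + y) = q x + q y" for x y
    using super[of x y] sublinear_add[OF q, of x y] by simp
  have minus: "q (- x) = - q x" for x
    using add[of x "- x"] sublinear_zero[OF q] by simp
  have "q (c *\<^sub>R x) = c * q x" for c x
  proof (cases c "0::real" rule: linorder_cases)
    case less
    then show ?thesis
      using sublinear_scaleR[OF q, of "- c" x] minus[of "c *\<^sub>R x"] by simp
  next
    case equal
    then show ?thesis by (simp add: sublinear_zero[OF q])
  next
    case greater
    then show ?thesis by (rule sublinear_scaleR[OF q])
  qed
  then show ?thesis by (intro linearI) (simp_all add: add)
qed

lemma exists_linear_below_sublinear:
  assumes p: "sublinear p"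
  obtains g where "linear g" "g \<le> p"
proof -
  define S where "S = {q. sublinear q \<and> q \<le> p}"
  \<comment> \<open>The order is reversed, so that Zorn's lemma yields a minimal element instead of
    a maximal one.\<close>
  let ?R = "relation_of (\<ge>) S"
  have "\<exists>m\<in>S. \<forall>a\<in>S. m \<ge> a \<longrightarrow> a = m"
  proof (rule predicate_Zorn)
    show "partial_order_on S ?R"
      by (rule partial_order_on_relation_ofI) auto
    fix C assume C: "C \<in> Chains ?R"
    then have sub: "C \<subseteq> S" by (rule Chains_relation_of)
    show "\<exists>m\<in>S. \<forall>a\<in>C. a \<ge> m"
    \<comment> \<open>The infimum over an empty chain carries no information; \<open>p\<close>
      itself serves as the bound there.\<close>
    proof (cases "C = {}")
      case True
      then show ?thesis using p by (auto simp: S_def)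
    next
      case False
      have "r \<le> s \<or> s \<le> r" if "r \<in> C" "s \<in> C" for r s
        using C that by (auto simp: Chains_def relation_of_def)
      note inf = sublinear_INF_chain[OF False _ this, of p]
      obtain r where r: "r \<in> C" using False by blast
      let ?q = "\<lambda>x. INF r\<in>C. r x"
      have "sublinear ?q" "\<And>r. r \<in> C \<Longrightarrow> ?q \<le> r"
        using inf sub by (auto simp: S_def)
      moreover from this(2)[OF r] have "?q \<le> p"
        using r sub by (auto simp: S_def intro: order_trans)
      ultimately show ?thesis unfolding S_def by blast
    qed
  qed
  then obtain q where q: "sublinear q" "q \<le> p"
    and min: "\<And>r. sublinear r \<Longrightarrow> r \<le> p \<Longrightarrow> r \<le> q \<Longrightarrow> r = q"
    unfolding S_def by blast
  have "linear q"
    using q by (intro linear_if_minimal_sublinear min) (auto intro: order_trans)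
  then show ?thesis using q(2) that by blast
qed

theorem Hahn_Banach_sublinear:
  fixes p :: "'a::real_normed_vector \<Rightarrow> real"
  assumes p: "sublinear p" and bound: "\<And>x. p x \<le> L * norm x"
  obtains \<xi> :: "'a \<Rightarrow>\<^sub>L real" where "\<And>x. \<xi> x \<le> p x" "\<xi> z = p z"
proof -
  obtain r where r: "sublinear r" "\<And>x. r x \<le> p x" "\<And>x. r x \<le> p (x + z) - p z"
    using sublinear_sharpen[OF p] by blast
  obtain g where g: "linear g" "g \<le> r"
    using exists_linear_below_sublinear[OF r(1)] by blast
  have gp: "g x \<le> p x" for x
    using g(2) r(2)[of x] by (auto simp: le_fun_def intro: order_trans)
  have neg: "g (- x) = - g x" for x
    using linear_neg[OF g(1)] by simp
  \<comment> \<open>At \<open>- z\<close> the sharpened functional satisfies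
    \<open>r (- z) \<le> p 0 - p z = - p z\<close>, which gives
    \<open>g z \<ge> p z\<close>.\<close>
  have "- g z \<le> r (- z)"
    using g(2) neg[of z] le_funD by metis
  then have "g z = p z"
    using r(3)[of "- z"] sublinear_zero[OF p] gp[of z] by simp
  \<comment> \<open>The one-sided bound on \<open>p\<close>, used at \<open>x\<close> and at
    \<open>- x\<close>, controls the absolute value because \<open>g\<close> is odd.\<close>
  moreover have "bounded_linear g"
  proof (rule bounded_linear_intro[of g L])
    show "g (x + y) = g x + g y" "g (c *\<^sub>R x) = c *\<^sub>R g x" for x y c
      using g(1) by (simp_all add: linear_add linear_scale)
    show "norm (g x) \<le> norm x * L" for x
      using gp[of x] gp[of "- x"] bound[of x] bound[of "- x"] neg[of x]
      by (simp add: abs_le_iff mult.commute)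
  qed
  ultimately show ?thesis
    using that[of "Blinfun g"] gp by (simp add: bounded_linear_Blinfun_apply)
qed

section \<open>The Clarke derivative of a locally Lipschitz function\<close>

lemma clarke_derivative_le:
  assumes "\<forall>\<^sub>F (y, t) in nhds x \<times>\<^sub>F at_right 0. (J (y + t *\<^sub>R z) - J y) / t \<le> c"
  shows "clarke_derivative J x z \<le> ereal c"
  unfolding clarke_derivative_def
  using assms by (intro Limsup_bounded) (auto elim!: eventually_mono)

lemma clarke_derivative_lessD:
  assumes "clarke_derivative J x z < ereal c"
  shows "\<forall>\<^sub>F (y, t) in nhds x \<times>\<^sub>F at_right 0. (J (y + t *\<^sub>R z) - J y) / t < c"
  using Limsup_lessD[OF assms[unfolded clarke_derivative_def]]
  by (auto elim!: eventually_mono)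

lemma nhds_prod_at_right_nontrivial: "nhds x \<times>\<^sub>F at_right (0::real) \<noteq> bot"
  by (simp add: prod_filter_eq_bot)

text \<open>The base point of a difference quotient may be moved from \<open>y\<close> to
  \<open>y + t *\<^sub>R z\<close>; this is what makes the Clarke derivative subadditive.\<close>

lemma filterlim_shift:
  fixes x z :: "'a::real_normed_vector"
  shows "filterlim (\<lambda>(y, t). (y + t *\<^sub>R z, t)) (nhds x \<times>\<^sub>F at_right (0::real)) (nhds x \<times>\<^sub>F at_right 0)"
proof -
  have t: "((\<lambda>s. snd s) \<longlongrightarrow> 0) (nhds x \<times>\<^sub>F at_right (0::real))"
    using filterlim_snd filterlim_at by blast
  have "((\<lambda>s. fst s + snd s *\<^sub>R z) \<longlongrightarrow> x + 0 *\<^sub>R z) (nhds x \<times>\<^sub>F at_right (0::real))"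
    by (intro tendsto_intros t filterlim_fst)
  then show ?thesis
    unfolding case_prod_beta by (intro filterlim_Pair filterlim_snd) simp
qed

text \<open>Rescaling the step size serves positive homogeneity of the Clarke derivative.\<close>

lemma filterlim_scale_time:
  assumes "c > 0"
  shows "filterlim (\<lambda>(y, t). (y, c * t)) (nhds x \<times>\<^sub>F at_right (0::real)) (nhds x \<times>\<^sub>F at_right 0)"
proof -
  have "filterlim (\<lambda>t. c * t) (at_right 0) (at_right (0::real))"
    using assms by (auto simp: filterlim_at eventually_at_right_less
        intro!: tendsto_eq_intros eventually_mono[OF eventually_at_right_less])
  then show ?thesis
    unfolding case_prod_beta
    by (intro filterlim_Pair filterlim_fst filterlim_compose[OF _ filterlim_snd])
qed

lemma eventually_shift_small:
  fixes x z :: "'a::real_normed_vector"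
  assumes "r > 0"
  shows "\<forall>\<^sub>F (y, t) in nhds x \<times>\<^sub>F at_right (0::real).
    y \<in> ball x r \<and> y + t *\<^sub>R z \<in> ball x r \<and> t > 0"
proof -
  have ball: "\<forall>\<^sub>F y in nhds x. y \<in> ball x r"
    using assms by (intro eventually_nhds_in_open) auto
  have "\<forall>\<^sub>F s in nhds x \<times>\<^sub>F at_right (0::real). fst s \<in> ball x r"
    by (rule eventually_compose_filterlim[OF ball filterlim_fst])
  moreover have "\<forall>\<^sub>F s in nhds x \<times>\<^sub>F at_right (0::real). fst (case s of (y, t) \<Rightarrow> (y + t *\<^sub>R z, t)) \<in> ball x r"
    by (rule eventually_compose_filterlim[OF ball filterlim_compose[OF filterlim_fst filterlim_shift]])
  moreover have "\<forall>\<^sub>F s in nhds x \<times>\<^sub>F at_right (0::real). snd s > 0"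
    by (rule eventually_compose_filterlim[OF eventually_at_right_less filterlim_snd])
  ultimately show ?thesis
    by eventually_elim auto
qed

text \<open>Near \<open>x\<close> every difference quotient in direction \<open>z\<close> is at most
  \<open>L * norm z\<close> in absolute value, where the Lipschitz constant \<open>L\<close> depends
  on \<open>x\<close> but not on \<open>z\<close>.\<close>

lemma clarke_derivative_bounded:
  assumes "locally_lipschitz J"
  obtains L where "\<And>z. clarke_derivative J x z \<le> ereal (L * norm z)"
    "\<And>z. ereal (- (L * norm z)) \<le> clarke_derivative J x z"
proof -
  obtain r L where r: "r > 0" and L: "L-lipschitz_on (ball x r) J"
    using assms unfolding locally_lipschitz_def by blast
  have ev: "\<forall>\<^sub>F (y, t) in nhds x \<times>\<^sub>F at_right 0. \<bar>(J (y + t *\<^sub>R z) - J y) / t\<bar> \<le> L * norm z" for z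
    using eventually_shift_small[OF r, of x z]
  proof eventually_elim
    case (elim s)
    obtain y t where s: "s = (y, t)" by fastforce
    have "dist (J (y + t *\<^sub>R z)) (J y) \<le> L * dist (y + t *\<^sub>R z) y"
      using elim s by (intro lipschitz_onD[OF L]) auto
    then show ?case using elim s by (simp add: dist_norm field_simps)
  qed
  have "clarke_derivative J x z \<le> ereal (L * norm z)" for z
    by (intro clarke_derivative_le eventually_mono[OF ev[of z]]) (auto simp only: abs_le_iff)
  moreover have "ereal (- (L * norm z)) \<le> clarke_derivative J x z" for z
  proof (rule ccontr)
    assume "\<not> ?thesis"
    then have "\<forall>\<^sub>F (y, t) in nhds x \<times>\<^sub>F at_right 0. (J (y + t *\<^sub>R z) - J y) / t < - (L * norm z)"
      by (intro clarke_derivative_lessD) simp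
    with ev[of z] have "\<forall>\<^sub>F s in nhds x \<times>\<^sub>F at_right (0::real). False"
      by eventually_elim (auto simp: abs_le_iff simp del: abs_divide)
    then show False
      using nhds_prod_at_right_nontrivial[of x] by (simp add: trivial_limit_def)
  qed
  ultimately show ?thesis using that by blast
qed

lemma clarke_derivative_finite:
  assumes "locally_lipschitz J"
  shows "ereal (real_of_ereal (clarke_derivative J x z)) = clarke_derivative J x z"
proof -
  obtain L where "clarke_derivative J x z \<le> ereal (L * norm z)"
    "ereal (- (L * norm z)) \<le> clarke_derivative J x z"
    using clarke_derivative_bounded[OF assms] by blast
  then show ?thesis by (cases "clarke_derivative J x z") auto
qed

lemma clarke_derivative_sublinear:
  assumes J: "locally_lipschitz J"
  shows "sublinear (\<lambda>z. real_of_ereal (clarke_derivative J x z))"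
proof -
  define p where "p z = real_of_ereal (clarke_derivative J x z)" for z
  have p: "clarke_derivative J x z = ereal (p z)" for z
    unfolding p_def by (rule clarke_derivative_finite[OF J, symmetric])
  have "p (z + w) \<le> p z + p w" for z w
  proof (rule field_le_epsilon)
    fix e :: real assume e: "e > 0"
    have "clarke_derivative J x z < ereal (p z + e/2)" "clarke_derivative J x w < ereal (p w + e/2)"
      using e by (simp_all add: p)
    note ev = this[THEN clarke_derivative_lessD]
    \<comment> \<open>The increment is split at the intermediate point
      \<open>y + t *\<^sub>R z\<close>, which is the base point for the direction
      \<open>w\<close>.\<close>
    have "\<forall>\<^sub>F (y, t) in nhds x \<times>\<^sub>F at_right 0. (J (y + t *\<^sub>R (z + w)) - J y) / t \<le> p z + p w + e"
      using ev(1) eventually_compose_filterlim[OF ev(2) filterlim_shift[where z = z]]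
      by eventually_elim (auto simp: algebra_simps diff_divide_distrib)
    then have "ereal (p (z + w)) \<le> ereal (p z + p w + e)"
      unfolding p[symmetric] by (rule clarke_derivative_le)
    then show "p (z + w) \<le> p z + p w + e" by simp
  qed
  moreover have "p (c *\<^sub>R z) \<le> c * p z" if c: "c > 0" for c z
  proof (rule field_le_epsilon)
    fix e :: real assume e: "e > 0"
    \<comment> \<open>The quotient for \<open>c *\<^sub>R z\<close> with step \<open>t\<close> is
      \<open>c\<close> times the quotient for \<open>z\<close> with step \<open>c * t\<close>, so
      the tolerance \<open>e/c\<close> turns into \<open>e\<close>.\<close>
    have "clarke_derivative J x z < ereal (p z + e/c)"
      using e c by (simp add: p)
    note ev = clarke_derivative_lessD[OF this]
    have "\<forall>\<^sub>F (y, t) in nhds x \<times>\<^sub>F at_right 0. (J (y + t *\<^sub>R c *\<^sub>R z) - J y) / t \<le> c * p z + e"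
      using eventually_compose_filterlim[OF ev filterlim_scale_time[OF c]]
    proof eventually_elim
      case (elim s)
      obtain y t where s: "s = (y, t)" by fastforce
      from elim have "(J (y + t *\<^sub>R c *\<^sub>R z) - J y) / t / c < (c * p z + e) / c"
        using c by (simp add: s mult.commute add_divide_distrib)
      then have "(J (y + t *\<^sub>R c *\<^sub>R z) - J y) / t < c * p z + e"
        using c unfolding divide_less_cancel by linarith
      then show ?case by (simp add: s)
    qed
    then have "ereal (p (c *\<^sub>R z)) \<le> ereal (c * p z + e)"
      unfolding p[symmetric] by (rule clarke_derivative_le)
    then show "p (c *\<^sub>R z) \<le> c * p z + e" by simp
  qed
  ultimately show ?thesis by (simp add: sublinear_def flip: p_def)
qed

text \<open>The base point varies in the upper limit: a neighbourhood of \<open>x\<close> on which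
  the quotients stay below \<open>c\<close> is also a neighbourhood of every \<open>y\<close> close
  to \<open>x\<close>.\<close>

lemma clarke_derivative_upper_semicontinuous:
  assumes "clarke_derivative J x z < ereal c"
  shows "\<forall>\<^sub>F y in nhds x. clarke_derivative J y z \<le> ereal c"
proof -
  obtain P Q where P: "eventually P (nhds x)" and Q: "eventually Q (at_right (0::real))"
    and PQ: "\<And>y t. P y \<Longrightarrow> Q t \<Longrightarrow> (J (y + t *\<^sub>R z) - J y) / t < c"
    using clarke_derivative_lessD[OF assms] unfolding eventually_prod_filter by auto
  have "\<forall>\<^sub>F y in nhds x. eventually P (nhds y)"
    using P by (simp add: eventually_eventually)
  then show ?thesis
  proof eventually_elim
    case (elim y)
    then show ?case
      using Q PQ
      by (intro clarke_derivative_le)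
        (auto simp: eventually_prod_filter intro!: exI[of _ P] exI[of _ Q] less_imp_le)
  qed
qed

text \<open>The gradient consists of the bounded linear functionals below the sublinear map
  \<open>clarke_derivative J x\<close>, so Hahn--Banach gives one touching it at \<open>z\<close>.
  In particular the gradient is nonempty.\<close>

lemma clarke_gradient_attains:
  assumes J: "locally_lipschitz J"
  obtains \<xi> where "\<xi> \<in> clarke_gradient J x" "ereal (\<xi> z) = clarke_derivative J x z"
proof -
  let ?p = "\<lambda>z. real_of_ereal (clarke_derivative J x z)"
  obtain L where L: "\<And>z. clarke_derivative J x z \<le> ereal (L * norm z)"
    using clarke_derivative_bounded[OF J] by blast
  have "?p w \<le> L * norm w" for w
    using L[of w] clarke_derivative_finite[OF J, of x w] by (metis ereal_less_eq(3))
  then obtain \<xi> :: "'a \<Rightarrow>\<^sub>L real" where "\<And>w. \<xi> w \<le> ?p w" "\<xi> z = ?p z"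
    using Hahn_Banach_sublinear[OF clarke_derivative_sublinear[OF J]] by blast
  then show ?thesis
    using that[of \<xi>] clarke_derivative_finite[OF J, of x]
    by (auto simp: clarke_gradient_def) (metis ereal_less_eq(3))
qed

section \<open>Equivalence of the variational inequalities\<close>

theorem theorem9:
  fixes f :: "'v::banach \<Rightarrow>\<^sub>L real"
    and K :: "'v set"
    and Y :: "'e::banach set"
    and A :: "'v \<Rightarrow> ('v \<Rightarrow>\<^sub>L real)"
    and J :: "'x::banach \<Rightarrow> real"
    and h :: "'v \<Rightarrow> real"
    and \<gamma> :: "'v \<Rightarrow>\<^sub>L 'x"
    and b :: "'v \<Rightarrow> 'e \<Rightarrow> real"
    and u :: 'v
    and l :: 'e
  assumes "reflexive_space TYPE('v)" and "reflexive_space TYPE('e)"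
    and "K \<noteq> {}" and "closed K" and "convex K"
    and "Y \<noteq> {}" and "closed Y" and "convex Y"
    and A_limsup: "\<And>w v. Limsup (at_right 0)
          (\<lambda>t::real. ereal (blinfun_apply (A (t *\<^sub>R w + (1 - t) *\<^sub>R v)) (w - v)))
        \<le> ereal (blinfun_apply (A v) (w - v))"
    and monotone: "\<And>u v \<xi>\<^sub>u \<xi>\<^sub>v.
          \<lbrakk>\<xi>\<^sub>u \<in> clarke_gradient J (\<gamma> u); \<xi>\<^sub>v \<in> clarke_gradient J (\<gamma> v)\<rbrakk> \<Longrightarrow>
          blinfun_apply (A u + dual_adjoint \<gamma> \<xi>\<^sub>u - A v - dual_adjoint \<gamma> \<xi>\<^sub>v) (u - v) \<ge> h (u - v)"
    and "locally_lipschitz J"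
    and "h 0 = 0"
    and h_limsup: "\<And>v. Limsup (at_right 0) (\<lambda>t::real. ereal (h (t *\<^sub>R v) / t)) \<ge> 0"
    and "bounded_bilinear b"
    and "u \<in> K" and "l \<in> Y"
  shows "let
      S0 = ((\<forall>v\<in>K. ereal (A u (v - u) + b (v - u) l) + clarke_derivative J (\<gamma> u) (\<gamma> v - \<gamma> u)
                     \<ge> ereal (f (v - u)))
            \<and> (\<forall>\<rho>\<in>Y. b u (\<rho> - l) \<le> 0));
      S1 = ((\<forall>v\<in>K. ereal (A v (v - u) + b (v - u) l) + clarke_derivative J (\<gamma> v) (\<gamma> v - \<gamma> u)
                     \<ge> ereal (f (v - u) + h (v - u)))
            \<and> (\<forall>\<rho>\<in>Y. b u (\<rho> - l) \<le> 0));
      S2 = (\<forall>v\<in>K. \<forall>\<rho>\<in>Y.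
              ereal (A u (v - u) + b v l - b u \<rho>) + clarke_derivative J (\<gamma> u) (\<gamma> v - \<gamma> u)
                \<ge> ereal (f (v - u)));
      S3 = (\<forall>v\<in>K. \<forall>\<rho>\<in>Y.
              ereal (A v (v - u) + b v l - b u \<rho>) + clarke_derivative J (\<gamma> v) (\<gamma> v - \<gamma> u)
                \<ge> ereal (f (v - u) + h (v - u)))
    in (S0 \<longleftrightarrow> S1) \<and> (S0 \<longleftrightarrow> S2) \<and> (S0 \<longleftrightarrow> S3)"
proof -
  note J = \<open>locally_lipschitz J\<close>
  interpret b: bounded_bilinear b by fact
  define D where "D x z = real_of_ereal (clarke_derivative J x z)" for x z
  have D: "clarke_derivative J x z = ereal (D x z)" for x z
    unfolding D_def by (rule clarke_derivative_finite[OF J, symmetric])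
  have subl: "sublinear (D x)" for x
    using clarke_derivative_sublinear[OF J, of x] by (simp add: D_def[abs_def])
  have D0: "D x 0 = 0" for x
    by (rule sublinear_zero[OF subl])

  have mono: "A u (v - u) + D (\<gamma> u) (\<gamma> v - \<gamma> u) + h (v - u) \<le> A v (v - u) + D (\<gamma> v) (\<gamma> v - \<gamma> u)" for v
  proof -
    \<comment> \<open>On the side of \<open>u\<close> the pairing must equal the Clarke derivative,
      hence the attaining \<xi>. On the side of \<open>v\<close> an upper bound suffices, so any
      \<eta> will do.\<close>
    obtain \<xi> where \<xi>: "\<xi> \<in> clarke_gradient J (\<gamma> u)" "\<xi> (\<gamma> v - \<gamma> u) = D (\<gamma> u) (\<gamma> v - \<gamma> u)"
      using clarke_gradient_attains[OF J] D by (metis ereal.inject)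
    obtain \<eta> where \<eta>: "\<eta> \<in> clarke_gradient J (\<gamma> v)"
      using clarke_gradient_attains[OF J] by blast
    then have "\<eta> (\<gamma> v - \<gamma> u) \<le> D (\<gamma> v) (\<gamma> v - \<gamma> u)"
      by (simp add: clarke_gradient_def D)
    then show ?thesis
      using monotone[OF \<eta> \<xi>(1)] \<xi>(2)
      by (simp add: dual_adjoint_def blinfun.bilinear_simps)
  qed

  have minty: "f (v - u) \<le> A u (v - u) + b (v - u) l + D (\<gamma> u) (\<gamma> v - \<gamma> u)"
    if S1: "\<And>v. v \<in> K \<Longrightarrow> f (v - u) + h (v - u) \<le> A v (v - u) + b (v - u) l + D (\<gamma> v) (\<gamma> v - \<gamma> u)"
      and v: "v \<in> K" for v
  proof (rule field_le_epsilon)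
    \<comment> \<open>The error \<open>e\<close> is shared equally among \<open>A\<close>, the
      Clarke derivative and \<open>h\<close>.\<close>
    fix e :: real assume e: "e > 0"
    define w where "w t = t *\<^sub>R v + (1 - t) *\<^sub>R u" for t :: real
    have w: "w t - u = t *\<^sub>R (v - u)" for t
      by (simp add: w_def algebra_simps)
    have "Limsup (at_right 0) (\<lambda>t. ereal (A (w t) (v - u))) < ereal (A u (v - u) + e/3)"
      unfolding w_def by (rule le_less_trans[OF A_limsup]) (use e in simp)
    then have evA: "\<forall>\<^sub>F t in at_right 0. A (w t) (v - u) < A u (v - u) + e/3"
      using Limsup_lessD by fastforce
    have "((\<lambda>t. \<gamma> (w t)) \<longlongrightarrow> \<gamma> (0 *\<^sub>R v + (1 - 0) *\<^sub>R u)) (at_right 0)"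
      unfolding w_def by (intro tendsto_intros)
    then have lim: "((\<lambda>t. \<gamma> (w t)) \<longlongrightarrow> \<gamma> u) (at_right 0)" by simp
    have "clarke_derivative J (\<gamma> u) (\<gamma> v - \<gamma> u) < ereal (D (\<gamma> u) (\<gamma> v - \<gamma> u) + e/3)"
      using e by (simp add: D)
    from eventually_compose_filterlim[OF clarke_derivative_upper_semicontinuous[OF this] lim]
    have evD: "\<forall>\<^sub>F t in at_right 0. D (\<gamma> (w t)) (\<gamma> v - \<gamma> u) \<le> D (\<gamma> u) (\<gamma> v - \<gamma> u) + e/3"
      by (simp add: D)
    have evt: "\<forall>\<^sub>F t in at_right 0. 0 < t \<and> t < (1::real)"
      by (auto simp: eventually_at_right_field intro!: exI[of _ 1])
    \<comment> \<open>The upper limit of \<open>h (t *\<^sub>R (v - u)) / t\<close> being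
      nonnegative gives this bound only for arbitrarily small \<open>t\<close>, not for all of them.
      That is enough, since the other estimates hold eventually and so share some \<open>t\<close>
      with it.\<close>
    have frh: "\<exists>\<^sub>F t in at_right 0. - (e/3) < h (t *\<^sub>R (v - u)) / t"
    proof (rule ccontr)
      assume "\<not> ?thesis"
      then have "\<forall>\<^sub>F t in at_right 0. ereal (h (t *\<^sub>R (v - u)) / t) \<le> ereal (- (e/3))"
        by (auto simp: not_frequently not_less elim: eventually_mono)
      from order_trans[OF h_limsup Limsup_bounded[OF this]] show False
        using e by simp
    qed
    obtain t where t: "0 < t" "t < 1" and tA: "A (w t) (v - u) < A u (v - u) + e/3"
      and tD: "D (\<gamma> (w t)) (\<gamma> v - \<gamma> u) \<le> D (\<gamma> u) (\<gamma> v - \<gamma> u) + e/3"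
      and th: "- (e/3) < h (t *\<^sub>R (v - u)) / t"
      using frequently_ex[OF frequently_eventually_conj[OF frh
        eventually_conj[OF evA eventually_conj[OF evD evt]]]] by auto
    have "w t \<in> K"
      unfolding w_def using \<open>convex K\<close> v \<open>u \<in> K\<close> t by (intro convexD) auto
    moreover have "\<gamma> (w t) - \<gamma> u = t *\<^sub>R (\<gamma> v - \<gamma> u)"
      by (simp flip: w blinfun.diff_right add: blinfun.scaleR_right) (simp add: w blinfun.scaleR_right blinfun.diff_right)
    \<comment> \<open>All terms but \<open>h\<close> are positively homogeneous in the direction
      \<open>w t - u = t *\<^sub>R (v - u)\<close>.\<close>
    ultimately have "t * f (v - u) + h (t *\<^sub>R (v - u))
        \<le> t * A (w t) (v - u) + t * b (v - u) l + t * D (\<gamma> (w t)) (\<gamma> v - \<gamma> u)"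
      using S1[of "w t"] sublinear_scaleR[OF subl t(1)]
      by (simp add: w blinfun.scaleR_right b.scaleR_left)
    then have "f (v - u) + h (t *\<^sub>R (v - u)) / t
        \<le> A (w t) (v - u) + b (v - u) l + D (\<gamma> (w t)) (\<gamma> v - \<gamma> u)"
      using t(1) by (simp add: field_simps)
    then show "f (v - u) \<le> A u (v - u) + b (v - u) l + D (\<gamma> u) (\<gamma> v - \<gamma> u) + e"
      using tA tD th by linarith
  qed

  \<comment> \<open>Forwards, \<open>b v l - b u \<rho> = b (v - u) l - b u (\<rho> - l)\<close>.
    Backwards, \<open>\<rho> = l\<close> gives the first conjunct, and \<open>v = u\<close>, where
    \<open>F\<close> and \<open>G\<close> cancel, gives the second.\<close>
  have split: "((\<forall>v\<in>K. F v \<le> G v + b (v - u) l) \<and> (\<forall>\<rho>\<in>Y. b u (\<rho> - l) \<le> 0))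
      \<longleftrightarrow> (\<forall>v\<in>K. \<forall>\<rho>\<in>Y. F v \<le> G v + b v l - b u \<rho>)" (is "?lhs \<longleftrightarrow> ?rhs")
    if FG: "F u = G u" for F G
  proof
    assume ?lhs
    then show ?rhs
      by (fastforce simp: b.diff_left b.diff_right)
  next
    assume R: ?rhs
    have "F v \<le> G v + b (v - u) l" if "v \<in> K" for v
      using R that \<open>l \<in> Y\<close> by (force simp: b.diff_left)
    moreover have "b u (\<rho> - l) \<le> 0" if "\<rho> \<in> Y" for \<rho>
      using R that \<open>u \<in> K\<close> FG by (force simp: b.diff_right)
    ultimately show ?lhs by blast
  qed
  note split0 = split[of "\<lambda>v. f (v - u)" "\<lambda>v. A u (v - u) + D (\<gamma> u) (\<gamma> v - \<gamma> u)"]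
  note split1 = split[of "\<lambda>v. f (v - u) + h (v - u)" "\<lambda>v. A v (v - u) + D (\<gamma> v) (\<gamma> v - \<gamma> u)"]

  \<comment> \<open>The condition on \<rho> is common to (0) and (i), so only the inequalities over
    \<open>K\<close> need comparing.\<close>
  have S01: "(\<forall>v\<in>K. f (v - u) \<le> A u (v - u) + b (v - u) l + D (\<gamma> u) (\<gamma> v - \<gamma> u)) \<longleftrightarrow>
      (\<forall>v\<in>K. f (v - u) + h (v - u) \<le> A v (v - u) + b (v - u) l + D (\<gamma> v) (\<gamma> v - \<gamma> u))"
  proof (intro iffI ballI)
    fix v
    assume "\<forall>v\<in>K. f (v - u) \<le> A u (v - u) + b (v - u) l + D (\<gamma> u) (\<gamma> v - \<gamma> u)" "v \<in> K"
    then have "f (v - u) \<le> A u (v - u) + b (v - u) l + D (\<gamma> u) (\<gamma> v - \<gamma> u)" by blast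
    with mono[of v] show "f (v - u) + h (v - u) \<le> A v (v - u) + b (v - u) l + D (\<gamma> v) (\<gamma> v - \<gamma> u)"
      by linarith
  qed (use minty in blast)
  show ?thesis
    unfolding Let_def D plus_ereal.simps ereal_less_eq
    using split0 split1 S01 by (simp add: D0 \<open>h 0 = 0\<close> ac_simps diff_add_eq add_diff_eq)
qed

end
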